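(* Let $P$ be a polytope as in the context. Every weight function $w$ of $P$ can be decomposed into a coherent sum of prime weight functions: there are prime weight functions $p_1,\dots,p_k$ of $P$ such that $w=p_1+\dots+p_k$ is a coherent decomposition.
   Context: Let $P\subset\mathbb R^{d+1}$ be a $d$-dimensional polytope with vertex matrix $V$ ($n\times(d+1)$) whose column span contains the all-ones vector. A weight function is $w\in\mathbb R^n$; envelope $\mathcal E_w(P)=\{x:Vx\ge -w\}$. A decomposition $w=w_1+\dots+w_m$ is coherent if $\mathcal E_{w_1}(P)+\dots+\mathcal E_{w_m}(P)=\mathcal E_w(P)$. Coherency index: $\alpha^w_{w'}=\min_{x\in\mathrm{Vert}\,\mathcal E_w(P)}\max_{x'\in\mathrm{Vert}\,\mathcal E_{w'}(P)}\min_{v\in V_{w'}(x')}\frac{\langle v,x\rangle+w(v)}{\langle v,x'\rangle+w'(v)}$ with $V_{w'}(x')=\{v\in\mathrm{Vert}(P):\langle v,x'\rangle\neq -w'(v)\}$. Weight functions are considered modulo the space of (restrictions of) affine functions. A weight function $w$ is prime if every weight function $w'$ with $\alpha^w_{w'}>0$ satisfies $w'=\lambda w$ modulo affine functions for some $\lambda>0$. *)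

theory Defs
  imports "HOL-Analysis.Analysis"
begin

definition vertices :: "'a::euclidean_space set \<Rightarrow> 'a set" where
  "vertices P = {v. v extreme_point_of P}"

(* A weight function on P is a function w :: 'a => real of which only the values on vertices P
   matter; all notions below, and all equations between weight functions, are restricted to
   vertices P.  The rows of the vertex matrix V are the elements of vertices P, so V x >= -w
   reads v \<bullet> x >= - w v for every vertex v. *)

definition envelope :: "'a::euclidean_space set \<Rightarrow> ('a \<Rightarrow> real) \<Rightarrow> 'a set" where
  "envelope P w = {x. \<forall>v\<in>vertices P. v \<bullet> x \<ge> - w v}"

definition affine_weight :: "'a::euclidean_space set \<Rightarrow> ('a \<Rightarrow> real) \<Rightarrow> bool" where
  "affine_weight P w \<longleftrightarrow> (\<exists>a b. \<forall>v\<in>vertices P. w v = a \<bullet> v + b)"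

(* The sum of sets is the Minkowski sum of HOL-Library.Set_Algebras.  The empty Minkowski sum
   is {0}, which is not an envelope of a polytope whose vertices lie on an affine hyperplane
   missing the origin (such envelopes are unbounded), so m = 0 does not occur there. *)
definition coherent_decomposition ::
  "'a::euclidean_space set \<Rightarrow> ('a \<Rightarrow> real) \<Rightarrow> nat \<Rightarrow> (nat \<Rightarrow> 'a \<Rightarrow> real) \<Rightarrow> bool" where
  "coherent_decomposition P w m ws \<longleftrightarrow>
     (\<forall>v\<in>vertices P. w v = (\<Sum>i=1..m. ws i v)) \<and>
     (\<Sum>i=1..m. envelope P (ws i)) = envelope P w"

definition nontight_vertices :: "'a::euclidean_space set \<Rightarrow> ('a \<Rightarrow> real) \<Rightarrow> 'a \<Rightarrow> 'a set" where
  "nontight_vertices P w x = {v \<in> vertices P. v \<bullet> x \<noteq> - w v}"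

(* The innermost minimum ranges over the empty set exactly when w' v = - (v \<bullet> x') for all
   vertices v, which forces w' to be affine; the index is meaningful only for w' that is
   not affine. *)
definition coherency_index ::
  "'a::euclidean_space set \<Rightarrow> ('a \<Rightarrow> real) \<Rightarrow> ('a \<Rightarrow> real) \<Rightarrow> real" where
  "coherency_index P w w' =
     (MIN x \<in> vertices (envelope P w).
        MAX x' \<in> vertices (envelope P w').
          MIN v \<in> nontight_vertices P w' x'. (v \<bullet> x + w v) / (v \<bullet> x' + w' v))"

(* w' ranges over the weight functions for which the index is defined, i.e. those that are
   nonzero modulo affine functions.  (Reading the minimum over the empty set as infinity and
   admitting w' = 0 would leave no prime weight functions except the affine ones.)
   With this definition affine weight functions themselves are prime. *)
definition prime_weight :: "'a::euclidean_space set \<Rightarrow> ('a \<Rightarrow> real) \<Rightarrow> bool" where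
  "prime_weight P w \<longleftrightarrow>
     (\<forall>w'. \<not> affine_weight P w' \<and> coherency_index P w w' > 0 \<longrightarrow>
        (\<exists>c>0. affine_weight P (\<lambda>v. w' v - c * w v)))"

end

theory Submission
  imports Defs
begin

text \<open>
  Record a point of an envelope by its set of tight vertices, and call \<open>u\<close> coarser than
  \<open>w\<close> if every tight set of \<open>w\<close> is contained in a tight set of \<open>u\<close>; a positive coherency
  index implies this relation. The weights coarser than \<open>w\<close> form a convex cone which contains
  no line apart from affine weights, and the sum of two of them is coherent whenever it equals
  \<open>w\<close>. If \<open>w\<close> is not prime, some coarser \<open>w'\<close> is independent of \<open>w\<close>, and the cone cuts the
  plane spanned by \<open>w\<close> and \<open>w'\<close> in a planar cone with \<open>w\<close> in its interior. Thus \<open>w\<close> is a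
  coherent sum of weights on the two boundary rays. These are strictly coarser than \<open>w\<close>, and
  there are only finitely many families of tight sets, so the process terminates.
\<close>

section \<open>Tight sets and the coarsening preorder on weights\<close>

definition tight_vertices :: "'a::euclidean_space set \<Rightarrow> ('a \<Rightarrow> real) \<Rightarrow> 'a \<Rightarrow> 'a set" where
  "tight_vertices P w x = {v \<in> vertices P. v \<bullet> x = - w v}"

text \<open>The linear-algebra form of a vertex of the envelope: the tight equations determine the
  point.\<close>

definition basic_point :: "'a::euclidean_space set \<Rightarrow> ('a \<Rightarrow> real) \<Rightarrow> 'a \<Rightarrow> bool" where
  "basic_point P w x \<longleftrightarrow> x \<in> envelope P w \<and> span (tight_vertices P w x) = UNIV"

text \<open>For fixed \<open>w\<close> these \<open>u\<close> form the closed deformation cone of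
  \<open>envelope P w\<close>. Inclusion of tight sets, instead of equality, lets the boundary of
  the cone belong to it.\<close>

definition coarser :: "'a::euclidean_space set \<Rightarrow> ('a \<Rightarrow> real) \<Rightarrow> ('a \<Rightarrow> real) \<Rightarrow> bool" where
  "coarser P w u \<longleftrightarrow>
     (\<forall>x\<in>envelope P w. \<exists>y\<in>envelope P u. tight_vertices P w x \<subseteq> tight_vertices P u y)"

text \<open>Closing the tight sets downwards turns \<open>coarser\<close> into plain inclusion of
  families. For a finite vertex set this yields a termination measure.\<close>

definition tight_family :: "'a::euclidean_space set \<Rightarrow> ('a \<Rightarrow> real) \<Rightarrow> 'a set set" where
  "tight_family P w = {S. \<exists>x\<in>envelope P w. S \<subseteq> tight_vertices P w x}"

lemma envelope_iff: "x \<in> envelope P w \<longleftrightarrow> (\<forall>v\<in>vertices P. 0 \<le> v \<bullet> x + w v)"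
  unfolding envelope_def by (force simp: algebra_simps)

lemma tight_vertices_iff:
  "v \<in> tight_vertices P w x \<longleftrightarrow> v \<in> vertices P \<and> v \<bullet> x + w v = 0"
  unfolding tight_vertices_def by (auto simp: eq_neg_iff_add_eq_0)

lemma tight_vertices_subset: "tight_vertices P w x \<subseteq> vertices P"
  unfolding tight_vertices_def by auto

lemma coarser_refl: "coarser P w w"
  unfolding coarser_def by auto

lemma coarser_trans:
  assumes "coarser P w u" and "coarser P u t"
  shows "coarser P w t"
  using assms unfolding coarser_def by (meson subset_trans)

text \<open>The slack \<open>v \<bullet> x + w v\<close> is jointly linear in the point and the
  weight, so two vanishing slacks may be subtracted.\<close>

lemma tight_vertices_scaled_diff:
  assumes "v \<in> tight_vertices P w x" "v \<in> tight_vertices P u y"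
  shows "v \<in> tight_vertices P (\<lambda>v. w v - c * u v) (x - c *\<^sub>R y)"
proof -
  have "v \<bullet> (x - c *\<^sub>R y) + (w v - c * u v) = (v \<bullet> x + w v) - c * (v \<bullet> y + u v)"
    by (simp add: inner_diff_right algebra_simps)
  then show ?thesis using assms by (simp add: tight_vertices_iff)
qed

text \<open>By joint linearity of the slack, the same combination of the two witnesses is a witness;
  nonnegative coefficients keep it in the envelope.\<close>

lemma coarser_combination:
  assumes "coarser P w u" "coarser P w t" "a \<ge> 0" "b \<ge> 0"
  shows "coarser P w (\<lambda>v. a * u v + b * t v)"
  unfolding coarser_def
proof
  fix x assume "x \<in> envelope P w"
  then obtain y z where y: "y \<in> envelope P u" "tight_vertices P w x \<subseteq> tight_vertices P u y"
    and z: "z \<in> envelope P t" "tight_vertices P w x \<subseteq> tight_vertices P t z"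
    using assms(1,2) unfolding coarser_def by meson
  have eq: "v \<bullet> (a *\<^sub>R y + b *\<^sub>R z) + (a * u v + b * t v)
    = a * (v \<bullet> y + u v) + b * (v \<bullet> z + t v)" for v
    by (simp add: inner_add_right algebra_simps)
  show "\<exists>p\<in>envelope P (\<lambda>v. a * u v + b * t v).
    tight_vertices P w x \<subseteq> tight_vertices P (\<lambda>v. a * u v + b * t v) p"
  proof (intro bexI subsetI)
    show "a *\<^sub>R y + b *\<^sub>R z \<in> envelope P (\<lambda>v. a * u v + b * t v)"
      using y(1) z(1) assms(3,4) unfolding envelope_iff eq by simp
    fix v assume "v \<in> tight_vertices P w x"
    then have "v \<in> tight_vertices P u y" "v \<in> tight_vertices P t z" using y z by auto
    then show "v \<in> tight_vertices P (\<lambda>v. a * u v + b * t v) (a *\<^sub>R y + b *\<^sub>R z)"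
      unfolding tight_vertices_iff eq by simp
  qed
qed

lemma tight_family_mono: "coarser P w u \<Longrightarrow> tight_family P w \<subseteq> tight_family P u"
proof
  fix S assume "coarser P w u" "S \<in> tight_family P w"
  then show "S \<in> tight_family P u"
    unfolding coarser_def tight_family_def mem_Collect_eq by (meson subset_trans)
qed

lemma coarser_if_tight_family_subset: "tight_family P w \<subseteq> tight_family P u \<Longrightarrow> coarser P w u"
  unfolding coarser_def tight_family_def by blast

section \<open>Basic points of an envelope\<close>

text \<open>The difference \<open>x - y\<close> is orthogonal to a spanning set, hence to itself.
  Consequently the witnesses of \<open>coarser\<close> at basic points are unique.\<close>

lemma basic_point_unique:
  assumes "span S = UNIV" "S \<subseteq> tight_vertices P w x" "S \<subseteq> tight_vertices P w y"
  shows "x = y"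
proof -
  have "orthogonal (x - y) v" if "v \<in> S" for v
  proof -
    have "v \<bullet> x = - w v" "v \<bullet> y = - w v"
      using that assms(2,3) by (auto simp: tight_vertices_def)
    then show ?thesis by (simp add: orthogonal_def inner_commute[of _ v] inner_diff_right)
  qed
  then have "orthogonal (x - y) (x - y)"
    using orthogonal_to_span[of "x - y" S "x - y"] assms(1) by auto
  then show ?thesis by (simp add: orthogonal_def)
qed

text \<open>On a segment through \<open>x\<close>, a slack vanishing at \<open>x\<close> is a
  positive combination of two nonnegative slacks. So both endpoints share the tight set of
  \<open>x\<close> and coincide.\<close>

lemma basic_point_extreme:
  assumes "basic_point P w x"
  shows "x \<in> vertices (envelope P w)"
  unfolding vertices_def extreme_point_of_def mem_Collect_eq
proof (intro conjI ballI notI)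
  show "x \<in> envelope P w" using assms by (simp add: basic_point_def)
  fix a b assume a: "a \<in> envelope P w" and b: "b \<in> envelope P w"
    and seg: "x \<in> open_segment a b"
  then obtain t where t: "0 < t" "t < 1" and x: "x = (1 - t) *\<^sub>R a + t *\<^sub>R b" and "a \<noteq> b"
    unfolding in_segment by blast
  have "v \<bullet> a + w v = 0 \<and> v \<bullet> b + w v = 0" if "v \<in> tight_vertices P w x" for v
  proof -
    have "v \<bullet> x + w v = (1 - t) * (v \<bullet> a + w v) + t * (v \<bullet> b + w v)"
      unfolding x by (simp add: inner_add_right algebra_simps)
    then have "(1 - t) * (v \<bullet> a + w v) + t * (v \<bullet> b + w v) = 0"
      using that by (simp add: tight_vertices_iff)
    moreover have "0 \<le> v \<bullet> a + w v" "0 \<le> v \<bullet> b + w v"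
      using a b that by (auto simp: envelope_iff tight_vertices_iff)
    ultimately show ?thesis
      using t add_nonneg_eq_0_iff[of "(1 - t) * (v \<bullet> a + w v)" "t * (v \<bullet> b + w v)"] by simp
  qed
  then have "tight_vertices P w x \<subseteq> tight_vertices P w a" "tight_vertices P w x \<subseteq> tight_vertices P w b"
    using tight_vertices_subset[of P w x] by (force simp: tight_vertices_iff)+
  then have "a = b"
    using assms basic_point_unique unfolding basic_point_def by blast
  with \<open>a \<noteq> b\<close> show False ..
qed

section \<open>Envelopes of a polytope whose vertices lie on a hyperplane missing the origin\<close>

text \<open>The vector \<open>c\<close> in \<open>height\<close> expresses the all-ones vector as a
  combination of the columns of V; adding a multiple of \<open>c\<close> to a point shifts all
  slacks equally.\<close>

locale height_one_polytope =
  fixes P :: "'a::euclidean_space set"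
  assumes finite_vertices: "finite (vertices P)"
    and span_vertices: "span (vertices P) = UNIV"
    and height: "\<exists>c. \<forall>v\<in>vertices P. v \<bullet> c = 1"
begin

lemma finite_tight_vertices: "finite (tight_vertices P w x)"
  by (rule finite_subset[OF tight_vertices_subset finite_vertices])

lemma envelope_nonempty: "envelope P w \<noteq> {}"
proof -
  obtain c where c: "\<And>v. v \<in> vertices P \<Longrightarrow> v \<bullet> c = 1" using height by auto
  define t where "t = (\<Sum>v\<in>vertices P. \<bar>w v\<bar>)"
  have "0 \<le> v \<bullet> (t *\<^sub>R c) + w v" if "v \<in> vertices P" for v
    using member_le_sum[of v "vertices P" "\<lambda>v. \<bar>w v\<bar>"] that finite_vertices c[OF that]
    unfolding t_def by auto
  then have "t *\<^sub>R c \<in> envelope P w" by (simp add: envelope_iff)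
  then show ?thesis by auto
qed

text \<open>Vertices are singleton faces, and a polyhedron has finitely many faces. Hence the outer
  minimum and the maximum in the index range over finite sets.\<close>

lemma finite_vertices_envelope: "finite (vertices (envelope P w))"
proof -
  have "envelope P w = \<Inter> ((\<lambda>v. {x. v \<bullet> x \<ge> - w v}) ` vertices P)"
    by (auto simp: envelope_def)
  moreover have "polyhedron \<dots>"
    using finite_vertices by (intro polyhedron_Inter) (auto simp: polyhedron_halfspace_ge)
  ultimately have "finite {F. F face_of envelope P w}"
    by (simp add: finite_polyhedron_faces)
  moreover have "(\<lambda>x. {x}) ` vertices (envelope P w) \<subseteq> {F. F face_of envelope P w}"
    by (auto simp: vertices_def face_of_singleton)
  ultimately have "finite ((\<lambda>x. {x}) ` vertices (envelope P w))"
    by (rule finite_subset[rotated])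
  then show ?thesis by (rule finite_imageD) simp
qed

text \<open>The ratio test of the simplex method: \<open>r v\<close> is the step length at which the
  constraint of \<open>v\<close> becomes tight, and the smallest one is taken.\<close>

lemma envelope_exit:
  assumes x: "x \<in> envelope P w" and y: "\<And>v. v \<in> tight_vertices P w x \<Longrightarrow> v \<bullet> y = 0"
    and neg: "\<exists>v\<in>vertices P. v \<bullet> y < 0"
  obtains t where "t > 0" "x + t *\<^sub>R y \<in> envelope P w"
    "tight_vertices P w x \<subset> tight_vertices P w (x + t *\<^sub>R y)"
proof -
  define N where "N = {v \<in> vertices P. v \<bullet> y < 0}"
  define r where "r v = (v \<bullet> x + w v) / (- (v \<bullet> y))" for v
  define t where "t = Min (r ` N)"
  have fin: "finite (r ` N)" and ne: "r ` N \<noteq> {}"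
    using finite_vertices neg by (auto simp: N_def)
  obtain u where u: "u \<in> N" "t = r u" using Min_in[OF fin ne] by (auto simp: t_def)
  have "u \<notin> tight_vertices P w x" using u y by (auto simp: N_def)
  then have "0 < u \<bullet> x + w u" using x u by (force simp: tight_vertices_iff envelope_iff N_def)
  moreover have "u \<bullet> y < 0" using u by (simp add: N_def)
  ultimately have t0: "t > 0" unfolding u(2) r_def by (intro divide_pos_pos) auto
  have eq: "v \<bullet> (x + t *\<^sub>R y) + w v = (v \<bullet> x + w v) + t * (v \<bullet> y)" for v
    by (simp add: inner_add_right)
  have env: "x + t *\<^sub>R y \<in> envelope P w"
    unfolding envelope_iff eq
  proof
    fix v assume v: "v \<in> vertices P"
    then have xv: "0 \<le> v \<bullet> x + w v" using x by (simp add: envelope_iff)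
    show "0 \<le> (v \<bullet> x + w v) + t * (v \<bullet> y)"
    proof (cases "v \<in> N")
      case True
      then have "t \<le> r v" unfolding t_def using fin by simp
      moreover have "v \<bullet> y < 0" using True by (simp add: N_def)
      ultimately show ?thesis by (simp add: r_def field_simps)
    next
      case False
      then show ?thesis using v xv t0 by (simp add: N_def)
    qed
  qed
  have "u \<in> tight_vertices P w (x + t *\<^sub>R y)"
    using u unfolding tight_vertices_iff eq by (auto simp: r_def N_def)
  moreover have "tight_vertices P w x \<subseteq> tight_vertices P w (x + t *\<^sub>R y)"
    using y unfolding tight_vertices_iff[abs_def] eq by (auto simp: tight_vertices_iff inner_add_right)
  ultimately show ?thesis using that t0 env \<open>u \<notin> tight_vertices P w x\<close> by blast
qed

text \<open>A nonzero vector orthogonal to the tight set cannot be orthogonal to all vertices, since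
  these span; its sign is chosen to make some product negative.\<close>

lemma exit_direction:
  assumes "span (tight_vertices P w x) \<noteq> UNIV"
  obtains y where "\<exists>v\<in>vertices P. v \<bullet> y < 0" "\<And>v. v \<in> tight_vertices P w x \<Longrightarrow> v \<bullet> y = 0"
proof -
  obtain y where y: "y \<noteq> 0" "\<And>v. v \<in> tight_vertices P w x \<Longrightarrow> v \<bullet> y = 0"
    using span_not_UNIV_orthogonal[OF assms] by (metis inner_commute span_base)
  have "\<exists>v\<in>vertices P. v \<bullet> y \<noteq> 0"
  proof (rule ccontr)
    assume "\<not> ?thesis"
    then have "orthogonal y v" if "v \<in> vertices P" for v
      using that by (simp add: orthogonal_def inner_commute)
    then have "orthogonal y y"
      using orthogonal_to_span[of y "vertices P" y] span_vertices by auto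
    then show False using y by (simp add: orthogonal_def)
  qed
  then obtain v where v: "v \<in> vertices P" "v \<bullet> y \<noteq> 0" by blast
  show thesis
  proof (cases "v \<bullet> y < 0")
    case True
    then show thesis using that[of y] v y by blast
  next
    case False
    then have "v \<bullet> (- y) < 0" using v by simp
    then show thesis using that[of "- y"] v y by auto
  qed
qed

lemma card_tight_vertices_less:
  assumes "tight_vertices P w x \<subset> tight_vertices P w z"
  shows "card (vertices P) - card (tight_vertices P w z) < card (vertices P) - card (tight_vertices P w x)"
proof -
  have "card (tight_vertices P w x) < card (tight_vertices P w z)"
    using assms finite_tight_vertices by (simp add: psubset_card_mono)
  moreover have "card (tight_vertices P w z) \<le> card (vertices P)"
    by (simp add: card_mono finite_vertices tight_vertices_subset)
  ultimately show ?thesis by linarith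
qed

text \<open>Minkowski-Weyl in the form of an inclusion: an envelope is generated by its basic points
  under convex combinations and recession directions. The induction is on the number of vertices
  that are not tight.\<close>

lemma envelope_subset_if_basic_points:
  assumes conv: "convex S" and rec: "\<And>s y. \<lbrakk>s \<in> S; \<forall>v\<in>vertices P. 0 \<le> v \<bullet> y\<rbrakk> \<Longrightarrow> s + y \<in> S"
    and basic: "\<And>x. basic_point P w x \<Longrightarrow> x \<in> S"
  shows "envelope P w \<subseteq> S"
proof
  fix x assume "x \<in> envelope P w"
  then show "x \<in> S"
  proof (induction "card (vertices P) - card (tight_vertices P w x)" arbitrary: x rule: less_induct)
    case less
    have step: "z \<in> S" if "z \<in> envelope P w" "tight_vertices P w x \<subset> tight_vertices P w z" for z
      using less.hyps[OF card_tight_vertices_less] that by blast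
    show ?case
    proof (cases "span (tight_vertices P w x) = UNIV")
      case True
      then show ?thesis using basic less.prems by (simp add: basic_point_def)
    next
      case False
      then obtain y where y: "\<exists>v\<in>vertices P. v \<bullet> y < 0"
          "\<And>v. v \<in> tight_vertices P w x \<Longrightarrow> v \<bullet> y = 0"
        by (rule exit_direction) blast
      obtain t where t: "t > 0" "x + t *\<^sub>R y \<in> envelope P w"
          "tight_vertices P w x \<subset> tight_vertices P w (x + t *\<^sub>R y)"
        using envelope_exit[OF less.prems y(2) y(1)] .
      then have S1: "x + t *\<^sub>R y \<in> S" using step by blast
      show ?thesis
      proof (cases "\<exists>v\<in>vertices P. v \<bullet> (- y) < 0")
        \<comment> \<open>Here \<open>- y\<close> is a recession direction, and \<open>x\<close> is
          reached by going back along it from the exit point.\<close>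
        case False
        then have "\<forall>v\<in>vertices P. 0 \<le> v \<bullet> (t *\<^sub>R (- y))"
          using t(1) by (auto simp: not_less mult_le_0_iff)
        then show ?thesis using rec[OF S1, of "t *\<^sub>R (- y)"] by simp
      next
        case True
        obtain s where s: "s > 0" "x + s *\<^sub>R (- y) \<in> envelope P w"
            "tight_vertices P w x \<subset> tight_vertices P w (x + s *\<^sub>R (- y))"
          by (rule envelope_exit[OF less.prems _ True]) (use y(2) in auto)
        then have S2: "x + s *\<^sub>R (- y) \<in> S" using step by blast
        \<comment> \<open>Otherwise \<open>x\<close> lies between two exit points, and these weights
          cancel the contributions of \<open>y\<close>.\<close>
        have "(s / (s + t)) *\<^sub>R (x + t *\<^sub>R y) + (t / (s + t)) *\<^sub>R (x + s *\<^sub>R (- y)) \<in> S"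
          using s(1) t(1) by (intro convexD[OF conv S1 S2]) (auto simp flip: add_divide_distrib)
        moreover have "(s / (s + t)) *\<^sub>R (x + t *\<^sub>R y) + (t / (s + t)) *\<^sub>R (x + s *\<^sub>R (- y))
          = (s / (s + t) + t / (s + t)) *\<^sub>R x"
          by (simp add: algebra_simps)
        moreover have "s / (s + t) + t / (s + t) = 1"
          using s(1) t(1) by (simp flip: add_divide_distrib)
        ultimately show ?thesis by simp
      qed
    qed
  qed
qed

text \<open>Leaving through new constraints while keeping the old ones tight must stop at a point
  whose tight set spans.\<close>

lemma basic_point_above:
  assumes "x \<in> envelope P w"
  shows "\<exists>z. basic_point P w z \<and> tight_vertices P w x \<subseteq> tight_vertices P w z"
  using assms
proof (induction "card (vertices P) - card (tight_vertices P w x)" arbitrary: x rule: less_induct)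
  case less
  show ?case
  proof (cases "span (tight_vertices P w x) = UNIV")
    case True
    then show ?thesis using less.prems by (auto simp: basic_point_def)
  next
    case False
    then obtain y where y: "\<exists>v\<in>vertices P. v \<bullet> y < 0"
        "\<And>v. v \<in> tight_vertices P w x \<Longrightarrow> v \<bullet> y = 0"
      by (rule exit_direction) blast
    obtain t where t: "t > 0" "x + t *\<^sub>R y \<in> envelope P w"
        "tight_vertices P w x \<subset> tight_vertices P w (x + t *\<^sub>R y)"
      using envelope_exit[OF less.prems y(2) y(1)] .
    then show ?thesis using less.hyps[OF card_tight_vertices_less[OF t(3)] t(2)] by blast
  qed
qed

lemma basic_point_exists: "\<exists>x. basic_point P w x"
  using envelope_nonempty basic_point_above by blast

lemma coarser_if_basic_points:
  assumes "\<And>x. basic_point P w x \<Longrightarrow>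
    \<exists>y\<in>envelope P u. tight_vertices P w x \<subseteq> tight_vertices P u y"
  shows "coarser P w u"
  using assms basic_point_above unfolding coarser_def by (meson subset_trans)

section \<open>The cone of weights coarser than a given one\<close>

text \<open>For each basic point \<open>x\<close> a positive index provides a vertex
  \<open>y\<close> with all ratios positive. A vertex of \<open>P\<close> tight at \<open>x\<close>
  but not at \<open>y\<close> would contribute the ratio 0.\<close>

lemma coarser_if_coherency_index_pos:
  assumes aff: "\<not> affine_weight P u" and pos: "coherency_index P w u > 0"
  shows "coarser P w u"
  unfolding coarser_def
proof
  fix x0 assume "x0 \<in> envelope P w"
  then obtain x where x: "basic_point P w x" "tight_vertices P w x0 \<subseteq> tight_vertices P w x"
    using basic_point_above by blast
  define f where "f y v = (v \<bullet> x + w v) / (v \<bullet> y + u v)" for y v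
  define g where "g = (\<lambda>y. MIN v \<in> nontight_vertices P u y. f y v)"
  have "coherency_index P w u \<le> Max (g ` vertices (envelope P u))"
    unfolding coherency_index_def f_def g_def
    using basic_point_extreme[OF x(1)] finite_vertices_envelope by (intro Min_le) auto
  then have "Max (g ` vertices (envelope P u)) > 0" using pos by linarith
  moreover obtain z where "basic_point P u z" using basic_point_exists by blast
  ultimately obtain y where y: "y \<in> vertices (envelope P u)" "g y > 0"
    using Max_in[of "g ` vertices (envelope P u)"] finite_vertices_envelope basic_point_extreme
    by (smt (verit) empty_iff finite_imageI image_iff image_is_empty)
  then have yE: "y \<in> envelope P u" by (simp add: vertices_def extreme_point_of_def)
  have "v \<in> tight_vertices P u y" if v: "v \<in> tight_vertices P w x" for v
  proof (rule ccontr)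
    assume "v \<notin> tight_vertices P u y"
    then have "v \<in> nontight_vertices P u y"
      using v by (simp add: tight_vertices_def nontight_vertices_def)
    then have "g y \<le> f y v"
      unfolding g_def using finite_vertices by (intro Min_le) (auto simp: nontight_vertices_def)
    moreover have "f y v = 0" using v by (simp add: f_def tight_vertices_iff)
    ultimately show False using y by simp
  qed
  then show "\<exists>y\<in>envelope P u. tight_vertices P w x0 \<subseteq> tight_vertices P u y"
    using yE x by blast
qed

text \<open>This places \<open>w\<close> in the relative interior of its cone: its slacks at basic
  points are positive off the tight sets, and only finitely many of them have to survive the
  subtraction.\<close>

lemma coarser_subtract_small:
  assumes "coarser P w u"
  shows "\<exists>c>0. coarser P w (\<lambda>v. w v - c * u v)"
proof -
  define B where "B = {x. basic_point P w x}"
  have "finite B"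
    unfolding B_def by (rule finite_subset[OF _ finite_vertices_envelope[of w]]) (use basic_point_extreme in blast)
  obtain y where y: "\<And>x. x \<in> B \<Longrightarrow> y x \<in> envelope P u"
      "\<And>x. x \<in> B \<Longrightarrow> tight_vertices P w x \<subseteq> tight_vertices P u (y x)"
    using assms unfolding coarser_def B_def basic_point_def by simp metis
  \<comment> \<open>The summand 1 keeps the denominator positive where the slack of \<open>u\<close>
    vanishes.\<close>
  define d where "d = (\<lambda>(x, v). (v \<bullet> x + w v) / (1 + (v \<bullet> y x + u v)))"
  define D where "D = {p \<in> B \<times> vertices P. snd p \<notin> tight_vertices P w (fst p)}"
  \<comment> \<open>The inserted 1 keeps \<open>Min\<close> meaningful when \<open>D\<close> is
    empty.\<close>
  define c where "c = Min (insert 1 (d ` D))"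
  have "finite D" using \<open>finite B\<close> finite_vertices by (simp add: D_def)
  have gt: "v \<bullet> x + w v > 0" if "(x, v) \<in> D" for x v
    using that unfolding D_def B_def basic_point_def
    by (auto simp: envelope_iff tight_vertices_iff less_le)
  have ge: "v \<bullet> y x + u v \<ge> 0" if "x \<in> B" "v \<in> vertices P" for x v
    using y(1)[OF that(1)] that(2) by (simp add: envelope_iff)
  have "d p > 0" if "p \<in> D" for p
  proof -
    obtain x v where "p = (x, v)" by fastforce
    with gt[of x v] ge[of x v] that show ?thesis by (auto simp: d_def D_def)
  qed
  then have c0: "c > 0" using \<open>finite D\<close> by (simp add: c_def)
  have "coarser P w (\<lambda>v. w v - c * u v)"
  proof (intro coarser_if_basic_points bexI subsetI)
    fix x assume "basic_point P w x"
    then have x: "x \<in> B" by (simp add: B_def)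
    show tight: "v \<in> tight_vertices P (\<lambda>v. w v - c * u v) (x - c *\<^sub>R y x)"
      if "v \<in> tight_vertices P w x" for v
      using that y(2)[OF x] by (auto intro: tight_vertices_scaled_diff)
    show "x - c *\<^sub>R y x \<in> envelope P (\<lambda>v. w v - c * u v)"
      unfolding envelope_iff
    proof
      fix v assume v: "v \<in> vertices P"
      show "0 \<le> v \<bullet> (x - c *\<^sub>R y x) + (w v - c * u v)"
      proof (cases "v \<in> tight_vertices P w x")
        case True
        then show ?thesis using tight[OF True] by (simp add: tight_vertices_iff)
      next
        case False
        then have D: "(x, v) \<in> D" using x v by (simp add: D_def)
        then have "c \<le> d (x, v)" unfolding c_def using \<open>finite D\<close> by simp
        then have "c * (1 + (v \<bullet> y x + u v)) \<le> v \<bullet> x + w v"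
          using ge[OF x v] by (simp add: d_def field_simps)
        then show ?thesis using c0 by (simp add: inner_diff_right algebra_simps)
      qed
    qed
  qed
  then show ?thesis using c0 by blast
qed

text \<open>The cone is closed and contains no multiple of \<open>- t\<close> beyond some bound when
  added to \<open>u\<close>, so a largest admissible multiple of \<open>t\<close> exists.\<close>

lemma coarser_subtract_max:
  assumes u: "coarser P w u" and t: "coarser P w t" and aff: "\<not> affine_weight P t"
  shows "\<exists>c\<ge>0. coarser P w (\<lambda>v. u v - c * t v) \<and> (\<forall>d>c. \<not> coarser P w (\<lambda>v. u v - d * t v))"
proof -
  define B where "B = {x. basic_point P w x}"
  obtain y where y: "\<And>x. x \<in> B \<Longrightarrow> y x \<in> envelope P u"
      "\<And>x. x \<in> B \<Longrightarrow> tight_vertices P w x \<subseteq> tight_vertices P u (y x)"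
    using u unfolding coarser_def B_def basic_point_def by simp metis
  obtain z where z: "\<And>x. x \<in> B \<Longrightarrow> z x \<in> envelope P t"
      "\<And>x. x \<in> B \<Longrightarrow> tight_vertices P w x \<subseteq> tight_vertices P t (z x)"
    using t unfolding coarser_def B_def basic_point_def by simp metis
  have eq: "v \<bullet> (y x - c *\<^sub>R z x) + (u v - c * t v) = (v \<bullet> y x + u v) - c * (v \<bullet> z x + t v)" for c x v
    by (simp add: inner_diff_right algebra_simps)
  have tight: "tight_vertices P w x \<subseteq> tight_vertices P (\<lambda>v. u v - c * t v) (y x - c *\<^sub>R z x)"
    if "x \<in> B" for x c
    using y(2)[OF that] z(2)[OF that] tight_vertices_scaled_diff by blast
  \<comment> \<open>Uniqueness at basic points forces the witness to be
    \<open>y x - c *\<^sub>R z x\<close>, which reduces the relation to linear inequalities in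
    \<open>c\<close>.\<close>
  have iff: "coarser P w (\<lambda>v. u v - c * t v) \<longleftrightarrow>
      (\<forall>x\<in>B. \<forall>v\<in>vertices P. c * (v \<bullet> z x + t v) \<le> v \<bullet> y x + u v)" for c
  proof
    assume *: "coarser P w (\<lambda>v. u v - c * t v)"
    show "\<forall>x\<in>B. \<forall>v\<in>vertices P. c * (v \<bullet> z x + t v) \<le> v \<bullet> y x + u v"
    proof (intro ballI)
      fix x v assume x: "x \<in> B" and v: "v \<in> vertices P"
      then obtain p where p: "p \<in> envelope P (\<lambda>v. u v - c * t v)"
          "tight_vertices P w x \<subseteq> tight_vertices P (\<lambda>v. u v - c * t v) p"
        using * unfolding coarser_def B_def basic_point_def by blast
      have "p = y x - c *\<^sub>R z x"
        using basic_point_unique[OF _ p(2) tight[OF x]] x by (simp add: B_def basic_point_def)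
      then show "c * (v \<bullet> z x + t v) \<le> v \<bullet> y x + u v"
        using p(1) v eq[of v x c] by (auto simp: envelope_iff)
    qed
  next
    assume *: "\<forall>x\<in>B. \<forall>v\<in>vertices P. c * (v \<bullet> z x + t v) \<le> v \<bullet> y x + u v"
    show "coarser P w (\<lambda>v. u v - c * t v)"
    proof (intro coarser_if_basic_points bexI)
      fix x assume "basic_point P w x"
      then have x: "x \<in> B" by (simp add: B_def)
      show "tight_vertices P w x \<subseteq> tight_vertices P (\<lambda>v. u v - c * t v) (y x - c *\<^sub>R z x)"
        by (rule tight[OF x])
      show "y x - c *\<^sub>R z x \<in> envelope P (\<lambda>v. u v - c * t v)"
        unfolding envelope_iff eq using * x by simp
    qed
  qed
  define A where "A = {c. coarser P w (\<lambda>v. u v - c * t v)}"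
  obtain x0 where x0: "x0 \<in> B" using basic_point_exists by (auto simp: B_def)
  \<comment> \<open>If all slacks of \<open>t\<close> vanished at \<open>z x0\<close>, then
    \<open>t\<close> would be linear on the vertices; a positive slack bounds \<open>c\<close> from
    above.\<close>
  have "\<exists>v\<in>vertices P. v \<bullet> z x0 + t v \<noteq> 0"
  proof (rule ccontr)
    assume "\<not> ?thesis"
    then have "\<forall>v\<in>vertices P. t v = (- z x0) \<bullet> v + 0" by (auto simp: inner_commute eq_neg_iff_add_eq_0 add.commute)
    then show False using aff unfolding affine_weight_def by blast
  qed
  then obtain v0 where v0: "v0 \<in> vertices P" "v0 \<bullet> z x0 + t v0 > 0"
    using z(1)[OF x0] by (force simp: envelope_iff)
  have "c \<le> (v0 \<bullet> y x0 + u v0) / (v0 \<bullet> z x0 + t v0)" if "c \<in> A" for c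
    using that v0 x0 iff[of c] by (simp add: A_def pos_le_divide_eq)
  then have bdd: "bdd_above A" by (auto simp: bdd_above_def)
  have A0: "0 \<in> A" using u by (simp add: A_def)
  have A_iff: "c \<in> A \<longleftrightarrow> coarser P w (\<lambda>v. u v - c * t v)" for c
    by (simp add: A_def)
  have "Sup A \<in> A"
    unfolding A_iff iff
  proof (intro ballI)
    fix x v assume x: "x \<in> B" and v: "v \<in> vertices P"
    have ge: "v \<bullet> z x + t v \<ge> 0" using z(1)[OF x] v by (simp add: envelope_iff)
    show "Sup A * (v \<bullet> z x + t v) \<le> v \<bullet> y x + u v"
    proof (cases "v \<bullet> z x + t v = 0")
      case True
      then show ?thesis using y(1)[OF x] v by (simp add: envelope_iff)
    next
      case False
      have "Sup A \<le> (v \<bullet> y x + u v) / (v \<bullet> z x + t v)"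
      proof (rule cSup_least)
        show "A \<noteq> {}" using A0 by blast
        fix c assume "c \<in> A"
        then show "c \<le> (v \<bullet> y x + u v) / (v \<bullet> z x + t v)" 
          using False ge x v iff[of c] by (simp add: A_def pos_le_divide_eq)
      qed
      then show ?thesis using False ge by (simp add: pos_le_divide_eq)
    qed
  qed
  moreover have "Sup A \<ge> 0" using A0 bdd by (rule cSup_upper)
  moreover have "d \<notin> A" if "d > Sup A" for d using cSup_upper[OF _ bdd] that by force
  ultimately show ?thesis unfolding A_iff[symmetric] by blast
qed

text \<open>At a basic point the witnesses for \<open>u\<close> and its negative are
  \<open>y\<close> and \<open>- y\<close>. Every slack of \<open>u\<close> at \<open>y\<close> is
  then both nonnegative and nonpositive.\<close>

lemma affine_if_coarser_neg:
  assumes "coarser P w u" "coarser P w (\<lambda>v. - u v)"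
  shows "affine_weight P u"
proof -
  obtain x where x: "x \<in> envelope P w" "span (tight_vertices P w x) = UNIV"
    using basic_point_exists[of w] by (auto simp: basic_point_def)
  obtain y where y: "y \<in> envelope P u" "tight_vertices P w x \<subseteq> tight_vertices P u y"
    using assms(1) x unfolding coarser_def by blast
  obtain z where z: "z \<in> envelope P (\<lambda>v. - u v)"
      "tight_vertices P w x \<subseteq> tight_vertices P (\<lambda>v. - u v) z"
    using assms(2) x unfolding coarser_def by blast
  have "tight_vertices P (\<lambda>v. - u v) z = tight_vertices P u (- z)"
    by (auto simp: tight_vertices_iff)
  then have "y = - z" using basic_point_unique[OF x(2) y(2)] z(2) by simp
  then have "u v = (- y) \<bullet> v + 0" if "v \<in> vertices P" for v
    using y(1) z(1) that by (fastforce simp: envelope_iff inner_commute)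
  then show ?thesis unfolding affine_weight_def by blast
qed

text \<open>An affine weight has a point at which every vertex is tight, and a coarser weight
  inherits such a point.\<close>

lemma affine_if_coarser_affine:
  assumes w: "affine_weight P w" and u: "coarser P w u"
  shows "affine_weight P u"
proof -
  obtain a b where ab: "\<And>v. v \<in> vertices P \<Longrightarrow> w v = a \<bullet> v + b"
    using w by (auto simp: affine_weight_def)
  obtain c where c: "\<And>v. v \<in> vertices P \<Longrightarrow> v \<bullet> c = 1" using height by auto
  \<comment> \<open>The vector \<open>c\<close> of height one absorbs the constant term
    \<open>b\<close>.\<close>
  have "v \<bullet> (- a - b *\<^sub>R c) + w v = 0" if "v \<in> vertices P" for v
    using ab[OF that] c[OF that] by (simp add: inner_diff_right inner_commute)
  then have "- a - b *\<^sub>R c \<in> envelope P w" "tight_vertices P w (- a - b *\<^sub>R c) = vertices P"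
    by (auto simp: envelope_iff tight_vertices_iff)
  then obtain y where "vertices P \<subseteq> tight_vertices P u y"
    using u unfolding coarser_def by metis
  then have "u v = (- y) \<bullet> v + 0" if "v \<in> vertices P" for v
    using that by (fastforce simp: tight_vertices_iff inner_commute)
  then show ?thesis unfolding affine_weight_def by blast
qed

section \<open>Coherent splitting and the induction\<close>

text \<open>A basic point of \<open>w\<close> equals the sum of its two witnesses by uniqueness.
  Convexity and the common recession cone extend this to the whole envelope.\<close>

lemma envelope_add_if_coarser:
  assumes u: "coarser P w u" and t: "coarser P w t"
    and w: "\<And>v. v \<in> vertices P \<Longrightarrow> w v = u v + t v"
  shows "envelope P u + envelope P t = envelope P w"
proof
  show "envelope P u + envelope P t \<subseteq> envelope P w"
  proof
    fix p assume "p \<in> envelope P u + envelope P t"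
    then obtain y z where "p = y + z" "y \<in> envelope P u" "z \<in> envelope P t"
      by (auto elim: set_plus_elim)
    then show "p \<in> envelope P w" by (force simp: envelope_iff w inner_add_right)
  qed
  have conv: "convex (envelope P s)" for s
  proof -
    have "envelope P s = (\<Inter>v\<in>vertices P. {x. v \<bullet> x \<ge> - s v})" by (auto simp: envelope_def)
    then show ?thesis by (simp add: convex_INT convex_halfspace_ge)
  qed
  show "envelope P w \<subseteq> envelope P u + envelope P t"
  proof (rule envelope_subset_if_basic_points)
    show "convex (envelope P u + envelope P t)" by (intro convex_set_plus conv)
    show "s + y \<in> envelope P u + envelope P t"
      if s: "s \<in> envelope P u + envelope P t" and y: "\<forall>v\<in>vertices P. 0 \<le> v \<bullet> y" for s y
    proof -
      obtain p q where pq: "s = p + q" "p \<in> envelope P u" "q \<in> envelope P t"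
        using s by (auto elim: set_plus_elim)
      have "q + y \<in> envelope P t" using pq(3) y by (force simp: envelope_iff inner_add_right)
      then show ?thesis using pq by (metis add.assoc set_plus_intro)
    qed
    fix x assume x: "basic_point P w x"
    then obtain y z where y: "y \<in> envelope P u" "tight_vertices P w x \<subseteq> tight_vertices P u y"
      and z: "z \<in> envelope P t" "tight_vertices P w x \<subseteq> tight_vertices P t z"
      using u t unfolding coarser_def basic_point_def by meson
    have "tight_vertices P w x \<subseteq> tight_vertices P w (y + z)"
    proof
      fix v assume "v \<in> tight_vertices P w x"
      then have "v \<in> tight_vertices P u y" "v \<in> tight_vertices P t z" using y z by auto
      then show "v \<in> tight_vertices P w (y + z)"
        using w[of v] by (auto simp: tight_vertices_iff inner_add_right)
    qed
    then have "x = y + z"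
      using basic_point_unique[OF _ subset_refl] x unfolding basic_point_def by blast
    then show "x \<in> envelope P u + envelope P t" using y z by auto
  qed
qed

text \<open>The weights \<open>w1\<close> and \<open>w2\<close> generate the boundary rays of the
  planar cone, obtained by subtracting as much as possible of \<open>s\<close> from \<open>w\<close>
  and of \<open>w\<close> from \<open>s\<close>.\<close>

lemma split_nonprime_weight:
  assumes "\<not> prime_weight P w"
  obtains u t where "coarser P w u" "coarser P w t" "\<not> coarser P u w" "\<not> coarser P t w"
    "\<And>v. w v = u v + t v"
proof -
  obtain s where s: "\<not> affine_weight P s" "coherency_index P w s > 0"
      and indep: "\<And>c. c > 0 \<Longrightarrow> \<not> affine_weight P (\<lambda>v. s v - c * w v)"
    using assms unfolding prime_weight_def by blast
  have ws: "coarser P w s" using coarser_if_coherency_index_pos s by blast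
  have aff: "\<not> affine_weight P w" using affine_if_coarser_affine ws s by blast
  obtain c where c: "c \<ge> 0" "coarser P w (\<lambda>v. w v - c * s v)"
      "\<And>d. d > c \<Longrightarrow> \<not> coarser P w (\<lambda>v. w v - d * s v)"
    using coarser_subtract_max[OF coarser_refl ws s(1)] by blast
  obtain d where d: "d \<ge> 0" "coarser P w (\<lambda>v. s v - d * w v)"
      "\<And>e. e > d \<Longrightarrow> \<not> coarser P w (\<lambda>v. s v - e * w v)"
    using coarser_subtract_max[OF ws coarser_refl aff] by blast
  define w1 where "w1 = (\<lambda>v. w v - c * s v)"
  define w2 where "w2 = (\<lambda>v. s v - d * w v)"
  have c0: "c > 0"
    using coarser_subtract_small[OF ws] c(3) by (meson less_le_trans not_le)
  \<comment> \<open>If \<open>w\<close> were coarser than \<open>w1\<close>, so would be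
    \<open>s\<close>; a further small multiple of \<open>s\<close> could be subtracted, against the
    maximality of \<open>c\<close>.\<close>
  have n1: "\<not> coarser P w1 w"
  proof
    assume *: "coarser P w1 w"
    then obtain e where "e > 0" "coarser P w1 (\<lambda>v. w1 v - e * s v)"
      using coarser_subtract_small coarser_trans ws by blast
    moreover have "(\<lambda>v. w1 v - e * s v) = (\<lambda>v. w v - (c + e) * s v)"
      by (auto simp: w1_def algebra_simps)
    ultimately have "coarser P w (\<lambda>v. w v - (c + e) * s v)"
      using coarser_trans[of P w w1] c(2) by (simp add: w1_def)
    then show False using c(3)[of "c + e"] \<open>e > 0\<close> by simp
  qed
  have n2: "\<not> coarser P w2 w"
  proof
    assume *: "coarser P w2 w"
    then obtain e where "e > 0" "coarser P w2 (\<lambda>v. w2 v - e * w v)"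
      using coarser_subtract_small by blast
    moreover have "(\<lambda>v. w2 v - e * w v) = (\<lambda>v. s v - (d + e) * w v)"
      by (auto simp: w2_def algebra_simps)
    ultimately have "coarser P w (\<lambda>v. s v - (d + e) * w v)"
      using coarser_trans[of P w w2] d(2) by (simp add: w2_def)
    then show False using d(3)[of "d + e"] \<open>e > 0\<close> by simp
  qed
  \<comment> \<open>Eliminating \<open>s\<close> from the two definitions expresses \<open>w\<close>
    through the boundary weights.\<close>
  have comb: "(1 - c * d) * w v = w1 v + c * w2 v" for v
    by (simp add: w1_def w2_def algebra_simps)
  \<comment> \<open>Otherwise the cone would contain a line through nonaffine weights: spanned by
    \<open>w2\<close> if the product is 1, by \<open>w\<close> if it is larger.\<close>
  have "c * d < 1"
  proof (rule ccontr)
    assume "\<not> c * d < 1"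
    then consider "c * d = 1" | "c * d > 1" by linarith
    then show False
    proof cases
      case 1
      then have "w1 = (\<lambda>v. - (c * w2 v))" using comb by (auto simp: fun_eq_iff eq_neg_iff_add_eq_0)
      moreover have "coarser P w (\<lambda>v. c * w2 v)"
        using coarser_combination[OF d(2) d(2), of c 0] c(1) by (simp add: w2_def)
      ultimately have "affine_weight P (\<lambda>v. c * w2 v)"
        using affine_if_coarser_neg[of w "\<lambda>v. c * w2 v"] c(2) by (simp add: w1_def)
      then obtain a b where ab: "\<And>v. v \<in> vertices P \<Longrightarrow> c * w2 v = a \<bullet> v + b"
        by (auto simp: affine_weight_def)
      have "w2 v = (a /\<^sub>R c) \<bullet> v + b / c" if "v \<in> vertices P" for v
        using ab[OF that] c0 by (simp add: field_simps)
      then have "affine_weight P w2" unfolding affine_weight_def by blast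
      moreover have "d > 0" using 1 c0 d(1) by (cases "d = 0") auto
      \<comment> \<open>An affine \<open>w2\<close> makes \<open>s\<close> a positive multiple of
        \<open>w\<close> modulo affine weights, which the choice of \<open>s\<close>
        excludes.\<close>
      ultimately show False using indep[of d] by (simp add: w2_def)
    next
      case 2
      have "coarser P w (\<lambda>v. (1 / (c * d - 1)) * w1 v + (c / (c * d - 1)) * w2 v)"
        using c d 2 unfolding w1_def w2_def by (intro coarser_combination) auto
      moreover have "(1 / (c * d - 1)) * w1 v + (c / (c * d - 1)) * w2 v = - w v" for v
      proof -
        have "(1 / (c * d - 1)) * w1 v + (c / (c * d - 1)) * w2 v = (w1 v + c * w2 v) / (c * d - 1)"
          by (simp add: add_divide_distrib)
        also have "\<dots> = - w v" unfolding comb[symmetric] using 2 by (simp add: field_simps)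
        finally show ?thesis .
      qed
      ultimately have "coarser P w (\<lambda>v. - w v)" by simp
      then show False using affine_if_coarser_neg[OF coarser_refl] aff by blast
    qed
  qed
  define a where "a = 1 / (1 - c * d)"
  have a: "a > 0" using \<open>c * d < 1\<close> by (simp add: a_def)
  have scale: "coarser P f (\<lambda>v. e * f v)" if "e \<ge> 0" for f e
    using coarser_combination[OF coarser_refl coarser_refl that order_refl] by simp
  have ac: "a * c \<ge> 0" using a c by simp
  show ?thesis
  proof (rule that)
    show "coarser P w (\<lambda>v. a * w1 v)"
      using coarser_trans[OF c(2)] scale[of a w1] a by (simp add: w1_def)
    show "coarser P w (\<lambda>v. (a * c) * w2 v)"
      using coarser_trans[OF d(2)] scale[OF ac, of w2] by (simp add: w2_def)
    show "\<not> coarser P (\<lambda>v. a * w1 v) w"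
      using coarser_trans[OF scale] n1 a less_imp_le by blast
    show "\<not> coarser P (\<lambda>v. (a * c) * w2 v) w"
      using coarser_trans[OF scale[OF ac]] n2 by blast
    show "w v = a * w1 v + (a * c) * w2 v" for v
    proof -
      have "a * w1 v + (a * c) * w2 v = a * (w1 v + c * w2 v)" by (simp add: algebra_simps)
      also have "\<dots> = w v" unfolding comb[symmetric] using \<open>c * d < 1\<close> by (simp add: a_def)
      finally show ?thesis by simp
    qed
  qed
qed

lemma coherent_decomposition_append:
  assumes u: "coherent_decomposition P u k p" and t: "coherent_decomposition P t l q"
    and w: "\<And>v. v \<in> vertices P \<Longrightarrow> w v = u v + t v"
    and env: "envelope P u + envelope P t = envelope P w"
  shows "coherent_decomposition P w (k + l) (\<lambda>i. if i \<le> k then p i else q (i - k))"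
proof -
  \<comment> \<open>The codomain of \<open>f\<close> is left general to cover both the values at a
    vertex and the Minkowski sum of envelopes.\<close>
  have sum: "(\<Sum>i=1..k + l. f (if i \<le> k then p i else q (i - k)))
    = (\<Sum>i=1..k. f (p i)) + (\<Sum>i=1..l. f (q i))" for f :: "('a \<Rightarrow> real) \<Rightarrow> 'b::comm_monoid_add"
  proof -
    have "{1..k + l} = {1..k} \<union> {1 + k..l + k}" by auto
    then have "(\<Sum>i=1..k + l. f (if i \<le> k then p i else q (i - k)))
      = (\<Sum>i=1..k. f (if i \<le> k then p i else q (i - k)))
        + (\<Sum>i=1 + k..l + k. f (if i \<le> k then p i else q (i - k)))"
      by (simp add: sum.union_disjoint)
    also have "(\<Sum>i=1 + k..l + k. f (if i \<le> k then p i else q (i - k))) = (\<Sum>i=1..l. f (q i))"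
      unfolding sum.shift_bounds_cl_nat_ivl by (intro sum.cong) auto
    finally show ?thesis by simp
  qed
  show ?thesis
    using u t w env sum[of "\<lambda>f. f v" for v] sum[of "envelope P"]
    unfolding coherent_decomposition_def by simp
qed

text \<open>Induction on the number of sets of vertices outside the tight family, which drops under
  strict coarsening; a prime weight is its own decomposition.\<close>

lemma coherent_prime_decomposition:
  "\<exists>k p. (\<forall>i\<in>{1..k}. prime_weight P (p i)) \<and> coherent_decomposition P w k p"
proof (induction "card (Pow (vertices P)) - card (tight_family P w)" arbitrary: w rule: less_induct)
  case less
  show ?case
  proof (cases "prime_weight P w")
    case True
    then show ?thesis
      by (intro exI[of _ "1::nat"] exI[of _ "\<lambda>_. w"]) (simp add: coherent_decomposition_def)
  next
    case False
    then obtain u t where ut: "coarser P w u" "coarser P w t"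
      "\<not> coarser P u w" "\<not> coarser P t w" "\<And>v. w v = u v + t v"
      by (rule split_nonprime_weight) blast
    have decr: "card (Pow (vertices P)) - card (tight_family P s)
        < card (Pow (vertices P)) - card (tight_family P w)"
      if "coarser P w s" "\<not> coarser P s w" for s
    proof -
      have sub: "tight_family P s \<subseteq> Pow (vertices P)"
        using tight_vertices_subset[of P s] by (auto simp: tight_family_def)
      have "tight_family P w \<subset> tight_family P s"
        using tight_family_mono[OF that(1)] coarser_if_tight_family_subset[of P s w] that(2) by auto
      moreover have "finite (tight_family P s)"
        using sub finite_vertices by (simp add: finite_subset)
      ultimately have "card (tight_family P w) < card (tight_family P s)"
        by (simp add: psubset_card_mono)
      moreover have "card (tight_family P s) \<le> card (Pow (vertices P))"
        using sub finite_vertices by (intro card_mono) auto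
      ultimately show ?thesis by linarith
    qed
    obtain k p where p: "\<forall>i\<in>{1..k}. prime_weight P (p i)" "coherent_decomposition P u k p"
      using less.hyps[OF decr[OF ut(1,3)]] by blast
    obtain l q where q: "\<forall>i\<in>{1..l}. prime_weight P (q i)" "coherent_decomposition P t l q"
      using less.hyps[OF decr[OF ut(2,4)]] by blast
    have "coherent_decomposition P w (k + l) (\<lambda>i. if i \<le> k then p i else q (i - k))"
      using coherent_decomposition_append[OF p(2) q(2)] envelope_add_if_coarser[OF ut(1,2)] ut(5)
      by simp
    moreover have "prime_weight P (if i \<le> k then p i else q (i - k))" if "i \<in> {1..k + l}" for i
    proof (cases "i \<le> k")
      case True
      then show ?thesis using p(1) that by simp
    next
      case False
      then have "i - k \<in> {1..l}" using that by auto
      then show ?thesis using q(1) False by simp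
    qed
    ultimately show ?thesis
      by (intro exI[of _ "k + l"] exI[of _ "\<lambda>i. if i \<le> k then p i else q (i - k)"] conjI ballI)
  qed
qed

end

section \<open>Reduction of the geometric hypotheses to the spanning condition\<close>

theorem theorem2p11:
  fixes P :: "'a::euclidean_space set" and w :: "'a \<Rightarrow> real"
  assumes "polytope P"
    and "aff_dim P = int DIM('a) - 1"
    and "\<exists>c. \<forall>v\<in>vertices P. v \<bullet> c = 1"
  shows "\<exists>k p. (\<forall>i\<in>{1..k}. prime_weight P (p i)) \<and> coherent_decomposition P w k p"
proof -
  obtain S where S: "finite S" "P = convex hull S" using assms(1) by (auto simp: polytope_def)
  have "finite (vertices P)"
    unfolding vertices_def S(2) by (rule finite_subset[OF extreme_points_of_convex_hull S(1)])
  moreover have "span (vertices P) = UNIV"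
  proof -
    have "P = convex hull (vertices P)"
      unfolding vertices_def using assms(1)
      by (intro Krein_Milman_Minkowski polytope_imp_compact polytope_imp_convex)
    then have dim: "aff_dim (vertices P) = int DIM('a) - 1"
      using assms(2) aff_dim_convex_hull[of "vertices P"] by simp
    obtain c where c: "\<forall>v\<in>vertices P. v \<bullet> c = 1" using assms(3) by blast
    \<comment> \<open>The hyperplane at height one misses the origin, so adjoining 0 raises the
      affine dimension to that of the whole space.\<close>
    have "affine hull (vertices P) \<subseteq> {x. c \<bullet> x = 1}"
      using c by (intro hull_minimal affine_hyperplane) (auto simp: inner_commute)
    then have "0 \<notin> affine hull (vertices P)" by auto
    then have "aff_dim (insert 0 (vertices P)) = int DIM('a)"
      using dim by (simp add: aff_dim_insert)
    then have "dim (insert 0 (vertices P)) = DIM('a)"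
      by (simp add: aff_dim_zero hull_inc)
    then show ?thesis by (simp add: dim_eq_full)
  qed
  ultimately interpret height_one_polytope P
    using assms(3) by unfold_locales
  show ?thesis by (rule coherent_prime_decomposition)
qed

end
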